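(* Consider the generalized Riemann problem for the 1D ten-moment equations with source, nonsonic case. Assume that the 2-shear wave associated with $u_1-\frac c{\sqrt3}$ moves to the left and the 5-shear wave associated with $u_1+\frac c{\sqrt3}$ moves to the right. Then, for $K=L,R$, $$g_{p_{22}}^{\ast\ast K}\left(\tfrac{\partial p_{22}}{\partial t}\right)_{\ast\ast K}=f_{p_{22}}^{\ast\ast K},$$ where $g_{p_{22}}^{\ast\ast L}=p_{11,\ast}(u_{1,\ast}-\lambda_2)$, $g_{p_{22}}^{\ast\ast R}=p_{11,\ast}(u_{1,\ast}-\lambda_5)$, $f_{p_{22}}^{\ast\ast K}=u_{1,\ast}\widetilde f_{p_{22}}^{\ast\ast K}+p_{11,\ast}\widehat f_{p_{22}}^{\ast\ast K}$, and, with $(i,K)=(2,L)$ or $(5,R)$, $$\widetilde f_{p_{22}}^{\ast\ast K}=(p_{22,\ast K}-p_{22,\ast\ast K})\left(\tfrac{\mathcal D_ip_{11}}{\mathcal D t}\right)_{\ast K}-2p_{12,\ast K}\left(\tfrac{\mathcal D_ip_{12}}{\mathcal D t}\right)_{\ast K}+2p_{12,\ast\ast}\left(\tfrac{\mathcal D_ip_{12}}{\mathcal D t}\right)_{\ast\ast K},$$ $$\widehat f_{p_{22}}^{\ast\ast K}=(u_{1,\ast}-\lambda_i)\left(\tfrac{\partial p_{22}}{\partial t}\right)_{\ast K}+\frac{\lambda_i}{3p_{11,\ast}^2}\left(p_{11,\ast}p_{22,\ast K}-4p_{12,\ast K}^2-p_{11,\ast}p_{22,\ast\ast K}+4p_{12,\ast\ast}^2\right)\left(\tfrac{\mathcal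 D p_{11}}{\mathcal D t}\right)_\ast+\frac{2\lambda_i}{p_{11,\ast}}\left[p_{12,\ast K}\left(\tfrac{\mathcal D p_{12}}{\mathcal D t}\right)_{\ast K}-p_{12,\ast\ast}\left(\tfrac{\mathcal D p_{12}}{\mathcal D t}\right)_{\ast\ast}\right],$$ with $$\left(\tfrac{\mathcal D_5p_{12}}{\mathcal D t}\right)_{\ast\ast R}=\left(\tfrac{\mathcal D p_{12}}{\mathcal D t}\right)_{\ast\ast}-\rho_{\ast R}(\lambda_5-u_{1,\ast})\left(\tfrac{\mathcal D u_2}{\mathcal D t}\right)_{\ast\ast}.$$
   Context: **System.** $\mathbf V=(\rho,u_1,u_2,p_{11},p_{12},p_{22})^\top$ with $\rho>0$, $p_{11}>0$, $p_{11}p_{22}-p_{12}^2>0$; $W(x)$ is a given $C^1$ potential; $c=\sqrt{3p_{11}/\rho}$; $\frac{\mathcal D}{\mathcal D t}=\partial_t+u_1\partial_x$. Smooth solutions satisfy: $\frac{\mathcal D\rho}{\mathcal D t}+\rho\partial_xu_1=0$; $\frac{\mathcal D u_1}{\mathcal D t}+\frac1\rho\partial_xp_{11}=-\frac12W_x$; $\frac{\mathcal D u_2}{\mathcal D t}+\frac1\rho\partial_xp_{12}=0$; $\frac{\mathcal D p_{11}}{\mathcal D t}+3p_{11}\partial_xu_1=0$; $\frac{\mathcal D p_{12}}{\mathcal D t}+2p_{12}\partial_xu_1+p_{11}\partial_xu_2=0$; $\frac{\mathcal D p_{22}}{\mathcal D t}+p_{22}\partial_xu_1+2p_{12}\partial_xu_2=0$.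 **Generalized Riemann problem.** The initial data are linear on each side of $x=0$. Near $(0,0)$, $0<t\ll1$, the solution is piecewise smooth; from left to right there are a 1-wave, a smooth 2-shear curve (speed $u_1-c/\sqrt3$), a contact curve (speed $u_1$), a smooth 5-shear curve (speed $u_1+c/\sqrt3$) and a 6-wave, and the four regions between consecutive waves are labelled $\ast L,\ast\ast L,\ast\ast R,\ast R$. In each of them $\mathbf V$ and its first derivatives have limits at $(0,0)$; a region subscript denotes that limit. The limiting states are $\mathbf V_{\ast L}=(\rho_{\ast L},u_{1,\ast},u_{2,\ast L},p_{11,\ast},p_{12,\ast L},p_{22,\ast L})$, $\mathbf V_{\ast\ast L}=(\rho_{\ast L},u_{1,\ast},u_{2,\ast\ast},p_{11,\ast},p_{12,\ast\ast},p_{22,\ast\ast L})$, $\mathbf V_{\ast\ast R}=(\rho_{\ast R},u_{1,\ast},u_{2,\ast\ast},p_{11,\ast},p_{12,\ast\ast},p_{22,\ast\ast R})$, $\mathbf V_{\ast R}=(\rho_{\ast R},u_{1,\ast},u_{2,\ast R},p_{11,\ast},p_{12,\ast R},p_{22,\ast R})$; $c_{\ast K}=\sqrt{3p_{11,\ast}/\rho_{\ast K}}$. Along the 2-shear curve $\rho,u_1,p_{11},u_2+\frac{p_{12}}{\sqrt{\rho p_{11}}},\det(\mathbf p)=p_{11}p_{22}-p_{12}^2$ are continuous; along the 5-shear curve $\rho,u_1,p_{11},u_2-\frac{p_{12}}{\sqrt{\rho p_{11}}},\det(\mathbf p)$ are continuous; along the contact $u_1,u_2,p_{11},p_{12}$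 are continuous. The limits $(\frac{\mathcal D u_1}{\mathcal D t})_\ast,(\frac{\mathcal D p_{11}}{\mathcal D t})_\ast$ are common to the four regions, and $(\frac{\mathcal D u_2}{\mathcal D t})_{\ast\ast},(\frac{\mathcal D p_{12}}{\mathcal D t})_{\ast\ast}$ are common to $\ast\ast L$ and $\ast\ast R$. Nonsonic: the $t$-axis lies between the 1-wave and the 6-wave. **Notation.** $\lambda_2=u_{1,\ast}-\frac{c_{\ast L}}{\sqrt3}$, $\lambda_5=u_{1,\ast}+\frac{c_{\ast R}}{\sqrt3}$, $\frac{\mathcal D_i}{\mathcal D t}=\partial_t+\lambda_i\partial_x$ ($i=2,5$). *)

theory Defs
  imports "HOL-Analysis.Analysis"
begin

(* Points of the plane are pairs (x, t). *)

type_synonym field = "real \<times> real \<Rightarrow> real"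

record flow =
  rho :: field
  u1 :: field
  u2 :: field
  p11 :: field
  p12 :: field
  p22 :: field

definition components :: "flow \<Rightarrow> field set" where
  "components V = {rho V, u1 V, u2 V, p11 V, p12 V, p22 V}"

definition dx :: "field \<Rightarrow> field" where
  "dx F z = deriv (\<lambda>x. F (x, snd z)) (fst z)"

definition dt :: "field \<Rightarrow> field" where
  "dt F z = deriv (\<lambda>t. F (fst z, t)) (snd z)"

(* The derivative d/dt + a d/dx.  The material derivative is D (u1 V). *)
definition D :: "field \<Rightarrow> field \<Rightarrow> field" where
  "D a F z = dt F z + a z * dx F z"

definition C1_on :: "(real \<times> real) set \<Rightarrow> field \<Rightarrow> bool" where
  "C1_on S F \<longleftrightarrow>
     (\<forall>z\<in>S. F differentiable (at z)) \<and> continuous_on S (dx F) \<and> continuous_on S (dt F)"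

type_synonym state = "real \<times> real \<times> real \<times> real \<times> real \<times> real"

definition state_at :: "flow \<Rightarrow> real \<times> real \<Rightarrow> state" where
  "state_at V z = (rho V z, u1 V z, u2 V z, p11 V z, p12 V z, p22 V z)"

definition admissible :: "state \<Rightarrow> bool" where
  "admissible = (\<lambda>(r, v1, v2, q11, q12, q22). r > 0 \<and> q11 > 0 \<and> q11 * q22 - q12\<^sup>2 > 0)"

definition c :: "flow \<Rightarrow> field" where
  "c V z = sqrt (3 * p11 V z / rho V z)"

definition det_p :: "flow \<Rightarrow> field" where
  "det_p V z = p11 V z * p22 V z - (p12 V z)\<^sup>2"

definition ten_moment_equations :: "(real \<Rightarrow> real) \<Rightarrow> flow \<Rightarrow> real \<times> real \<Rightarrow> bool" where
  "ten_moment_equations W V z \<longleftrightarrow>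
     D (u1 V) (rho V) z + rho V z * dx (u1 V) z = 0 \<and>
     D (u1 V) (u1 V) z + 1 / rho V z * dx (p11 V) z = - (1/2) * deriv W (fst z) \<and>
     D (u1 V) (u2 V) z + 1 / rho V z * dx (p12 V) z = 0 \<and>
     D (u1 V) (p11 V) z + 3 * p11 V z * dx (u1 V) z = 0 \<and>
     D (u1 V) (p12 V) z + 2 * p12 V z * dx (u1 V) z + p11 V z * dx (u2 V) z = 0 \<and>
     D (u1 V) (p22 V) z + p22 V z * dx (u1 V) z + 2 * p12 V z * dx (u2 V) z = 0"

definition smooth_solution_on :: "(real \<Rightarrow> real) \<Rightarrow> flow \<Rightarrow> (real \<times> real) set \<Rightarrow> bool" where
  "smooth_solution_on W V S \<longleftrightarrow>
     (\<forall>F\<in>components V. C1_on S F) \<and>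
     (\<forall>z\<in>S. admissible (state_at V z) \<and> ten_moment_equations W V z)"

(* A curve x = y t.  x1l, x1r are the left and right edges of the 1-wave and x6l, x6r those of
   the 6-wave: the two edges coincide for a shock and bound the fan of a rarefaction. *)
record waves =
  x1l :: "real \<Rightarrow> real"
  x1r :: "real \<Rightarrow> real"
  x2 :: "real \<Rightarrow> real"
  xc :: "real \<Rightarrow> real"
  x5 :: "real \<Rightarrow> real"
  x6l :: "real \<Rightarrow> real"
  x6r :: "real \<Rightarrow> real"

definition smooth_curve :: "real \<Rightarrow> (real \<Rightarrow> real) \<Rightarrow> bool" where
  "smooth_curve T y \<longleftrightarrow> y 0 = 0 \<and>
     (\<exists>y'. continuous_on {0..<T} y' \<and>
       (\<forall>t\<in>{0..<T}. (y has_real_derivative y' t) (at t within {0..<T})))"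

definition between :: "real \<Rightarrow> (real \<Rightarrow> real) \<Rightarrow> (real \<Rightarrow> real) \<Rightarrow> (real \<times> real) set" where
  "between T a b = {(x, t). 0 < t \<and> t < T \<and> a t < x \<and> x < b t}"

datatype side = L | R

fun star :: "waves \<Rightarrow> real \<Rightarrow> side \<Rightarrow> (real \<times> real) set" where
  "star w T L = between T (x1r w) (x2 w)"
| "star w T R = between T (x5 w) (x6l w)"

fun sstar :: "waves \<Rightarrow> real \<Rightarrow> side \<Rightarrow> (real \<times> real) set" where
  "sstar w T L = between T (x2 w) (xc w)"
| "sstar w T R = between T (xc w) (x5 w)"

fun outer :: "waves \<Rightarrow> real \<Rightarrow> real \<Rightarrow> side \<Rightarrow> (real \<times> real) set" where
  "outer w T X L = between T (\<lambda>t. - X) (x1l w)"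
| "outer w T X R = between T (x6r w) (\<lambda>t. X)"

fun initial_side :: "real \<Rightarrow> side \<Rightarrow> real set" where
  "initial_side X L = {- X<..<0}"
| "initial_side X R = {0<..<X}"

definition linear_data :: "flow \<Rightarrow> real \<Rightarrow> bool" where
  "linear_data V X \<longleftrightarrow>
     (\<forall>K. (\<forall>F\<in>components V. \<exists>a b. \<forall>x\<in>initial_side X K. F (x, 0) = a + b * x) \<and>
          (\<forall>x\<in>initial_side X K. admissible (state_at V (x, 0))))"

definition attains_data :: "flow \<Rightarrow> waves \<Rightarrow> real \<Rightarrow> real \<Rightarrow> bool" where
  "attains_data V w T X \<longleftrightarrow>
     (\<forall>K. \<forall>F\<in>components V. \<forall>x\<in>initial_side X K.
        (F \<longlongrightarrow> F (x, 0)) (at (x, 0) within outer w T X K))"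

(* Continuity along a discontinuity curve: the one-sided limits from the adjacent regions S, S'
   exist and agree.  Values of the flow on the curve itself are irrelevant. *)
definition continuous_along ::
    "real \<Rightarrow> (real \<Rightarrow> real) \<Rightarrow> (real \<times> real) set \<Rightarrow> (real \<times> real) set \<Rightarrow> field \<Rightarrow> bool" where
  "continuous_along T y S S' F \<longleftrightarrow>
     (\<forall>t\<in>{0<..<T}. \<exists>l. (F \<longlongrightarrow> l) (at (y t, t) within S) \<and> (F \<longlongrightarrow> l) (at (y t, t) within S'))"

definition moves_with_speed ::
    "real \<Rightarrow> (real \<Rightarrow> real) \<Rightarrow> (real \<times> real) set \<Rightarrow> (real \<times> real) set \<Rightarrow> field \<Rightarrow> bool" where
  "moves_with_speed T y S S' F \<longleftrightarrow>
     (\<forall>t\<in>{0<..<T}. (F \<longlongrightarrow> deriv y t) (at (y t, t) within S) \<and>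
                   (F \<longlongrightarrow> deriv y t) (at (y t, t) within S'))"

definition shear_2 :: "flow \<Rightarrow> waves \<Rightarrow> real \<Rightarrow> bool" where
  "shear_2 V w T \<longleftrightarrow>
     moves_with_speed T (x2 w) (star w T L) (sstar w T L) (\<lambda>z. u1 V z - c V z / sqrt 3) \<and>
     (\<forall>F\<in>{rho V, u1 V, p11 V, \<lambda>z. u2 V z + p12 V z / sqrt (rho V z * p11 V z), det_p V}.
        continuous_along T (x2 w) (star w T L) (sstar w T L) F)"

definition contact :: "flow \<Rightarrow> waves \<Rightarrow> real \<Rightarrow> bool" where
  "contact V w T \<longleftrightarrow>
     moves_with_speed T (xc w) (sstar w T L) (sstar w T R) (u1 V) \<and>
     (\<forall>F\<in>{u1 V, u2 V, p11 V, p12 V}. continuous_along T (xc w) (sstar w T L) (sstar w T R) F)"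

definition shear_5 :: "flow \<Rightarrow> waves \<Rightarrow> real \<Rightarrow> bool" where
  "shear_5 V w T \<longleftrightarrow>
     moves_with_speed T (x5 w) (sstar w T R) (star w T R) (\<lambda>z. u1 V z + c V z / sqrt 3) \<and>
     (\<forall>F\<in>{rho V, u1 V, p11 V, \<lambda>z. u2 V z - p12 V z / sqrt (rho V z * p11 V z), det_p V}.
        continuous_along T (x5 w) (sstar w T R) (star w T R) F)"

definition has_origin_limits :: "flow \<Rightarrow> (real \<times> real) set \<Rightarrow> bool" where
  "has_origin_limits V S \<longleftrightarrow>
     (\<forall>F\<in>components V. \<forall>G\<in>{F, dx F, dt F}. \<exists>l. (G \<longlongrightarrow> l) (at (0, 0) within S))"

(* The region subscript: the limit at the origin taken inside S. *)
definition lim0 :: "(real \<times> real) set \<Rightarrow> field \<Rightarrow> real" where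
  "lim0 S F = Lim (at (0, 0) within S) F"

definition lim_state :: "flow \<Rightarrow> (real \<times> real) set \<Rightarrow> state" where
  "lim_state V S =
     (lim0 S (rho V), lim0 S (u1 V), lim0 S (u2 V), lim0 S (p11 V), lim0 S (p12 V), lim0 S (p22 V))"

(* The solution near the origin, in |x| < X, 0 < t < T.  Nothing is required inside the 1-wave
   and the 6-wave, so that shocks and rarefactions are both covered. *)
definition grp_solution ::
    "(real \<Rightarrow> real) \<Rightarrow> flow \<Rightarrow> waves \<Rightarrow> real \<Rightarrow> real \<Rightarrow> bool" where
  "grp_solution W V w T X \<longleftrightarrow>
     T > 0 \<and> X > 0 \<and>
     (\<forall>x. W differentiable (at x)) \<and> continuous_on UNIV (deriv W) \<and>
     linear_data V X \<and> attains_data V w T X \<and>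
     (\<forall>y\<in>{x1l w, x1r w, x2 w, xc w, x5 w, x6l w, x6r w}. smooth_curve T y) \<and>
     (\<forall>t\<in>{0<..<T}. - X < x1l w t \<and> x1l w t \<le> x1r w t \<and> x1r w t < x2 w t \<and> x2 w t < xc w t \<and>
        xc w t < x5 w t \<and> x5 w t < x6l w t \<and> x6l w t \<le> x6r w t \<and> x6r w t < X) \<and>
     (\<forall>K. smooth_solution_on W V (outer w T X K) \<and>
          smooth_solution_on W V (star w T K) \<and> smooth_solution_on W V (sstar w T K)) \<and>
     shear_2 V w T \<and> contact V w T \<and> shear_5 V w T \<and>
     (\<forall>K. has_origin_limits V (star w T K) \<and> admissible (lim_state V (star w T K)) \<and>
          has_origin_limits V (sstar w T K) \<and> admissible (lim_state V (sstar w T K)))"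

definition nonsonic :: "waves \<Rightarrow> real \<Rightarrow> bool" where
  "nonsonic w T \<longleftrightarrow> (\<forall>t\<in>{0<..<T}. x1r w t < 0 \<and> 0 < x6l w t)"

end

theory Submission
  imports Defs
begin

text \<open>
  The unknown \<open>dt (p22 V)\<close> in an inner region is obtained by transporting information across the
  adjacent shear curve. The determinant \<open>p11 p22 - p12\<^sup>2\<close> and \<open>p11\<close> are continuous along that curve,
  so their derivatives in the direction of the curve have the same limit at the origin from both
  sides; at the origin that direction is the shear speed \<open>\<lambda>\<^sub>i\<close>. The product rule for the
  determinant then gives
  \<open>p11 (D\<^sub>i p22\<^sub>*\<^sub>* - D\<^sub>i p22\<^sub>*) = (p22\<^sub>* - p22\<^sub>*\<^sub>*) D\<^sub>i p11 - 2 p12\<^sub>* D\<^sub>i p12\<^sub>* + 2 p12\<^sub>*\<^sub>* D\<^sub>i p12\<^sub>*\<^sub>*\<close>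
  (lemma \<open>derivative_along_shear\<close>), whose right-hand side is \<open>f_tilde\<close>.

  To isolate the time derivative, the space derivative is eliminated by means of
  \<open>u1 D\<^sub>i = (u1 - \<lambda>\<^sub>i) \<partial>\<^sub>t + \<lambda>\<^sub>i D/Dt\<close>. The material derivative of \<open>p22\<close> is in turn expressed by
  those of \<open>p11\<close> and \<open>p12\<close>: the equation for \<open>p11\<close> determines \<open>\<partial>\<^sub>x u1\<close>, that for \<open>p12\<close> determines
  \<open>\<partial>\<^sub>x u2\<close>, and both enter the equation for \<open>p22\<close> (lemma \<open>equations_at_origin\<close>). This produces
  \<open>f_hat\<close>. The last claim is the equation for \<open>u2\<close> solved for \<open>\<partial>\<^sub>x p12\<close>.

  The analytic point is the first one. Derivatives of the flow converge at the origin, but nothing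
  is known about them at the other points of the shear curve, where only the one-sided traces
  are known to exist, so the chain rule does not apply to the trace. Lemma \<open>trace_increment\<close>
  estimates its increments instead, by the mean value theorem on curves pushed slightly into the region, and
  \<open>derivative_along_curve_agrees\<close> compares the estimates from the two sides.
\<close>

section \<open>The chain rule along curves\<close>

lemma dx_dt_of_has_derivative:
  assumes "(F has_derivative F') (at z)"
  shows "dx F z = F' (1, 0)" "dt F z = F' (0, 1)"
proof -
  interpret bounded_linear F' using assms by (rule has_derivative_bounded_linear)
  have l: "((\<lambda>x::real. (x, snd z)) has_derivative (\<lambda>h. (h, 0))) (at (fst z))"
    "((\<lambda>t::real. (fst z, t)) has_derivative (\<lambda>h. (0, h))) (at (snd z))"
    by (auto intro!: derivative_eq_intros)
  have "((\<lambda>x. F (x, snd z)) has_derivative (\<lambda>h. F' (h, 0))) (at (fst z))"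
    using has_derivative_compose[OF l(1), of F F'] assms by simp
  moreover have "(\<lambda>h. F' (h, 0)) = (*) (F' (1, 0))"
  proof
    show "F' (h, 0) = F' (1, 0) * h" for h using scaleR[of h "(1, 0)"] by simp
  qed
  ultimately show "dx F z = F' (1, 0)"
    unfolding dx_def by (intro DERIV_imp_deriv) (simp add: has_field_derivative_def)
  have "((\<lambda>t. F (fst z, t)) has_derivative (\<lambda>h. F' (0, h))) (at (snd z))"
    using has_derivative_compose[OF l(2), of F F'] assms by simp
  moreover have "(\<lambda>h. F' (0, h)) = (*) (F' (0, 1))"
  proof
    show "F' (0, h) = F' (0, 1) * h" for h using scaleR[of h "(0, 1)"] by simp
  qed
  ultimately show "dt F z = F' (0, 1)"
    unfolding dt_def by (intro DERIV_imp_deriv) (simp add: has_field_derivative_def)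
qed

lemma has_derivative_along_curve:
  fixes F :: field and y :: "real \<Rightarrow> real"
  assumes "F differentiable (at (y s, s))" and y: "(y has_real_derivative m) (at s)"
  shows "((\<lambda>s. F (y s, s)) has_real_derivative dt F (y s, s) + m * dx F (y s, s)) (at s)"
proof -
  obtain F' where F': "(F has_derivative F') (at (y s, s))"
    using assms(1) by (auto simp: differentiable_def)
  interpret bounded_linear F' using F' by (rule has_derivative_bounded_linear)
  have "((\<lambda>s. (y s, s)) has_derivative (\<lambda>h. (m * h, h))) (at s)"
    using y by (auto intro!: derivative_eq_intros simp: has_field_derivative_def)
  from has_derivative_compose[OF this F']
  have "((\<lambda>s. F (y s, s)) has_derivative (\<lambda>h. F' (m * h, h))) (at s)" .
  moreover have "F' (m * h, h) = (dt F (y s, s) + m * dx F (y s, s)) * h" for h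
  proof -
    have "F' (m * h, h) = F' ((m * h) *\<^sub>R (1, 0) + h *\<^sub>R (0, 1))" by simp
    also have "\<dots> = (m * h) * F' (1, 0) + h * F' (0, 1)" by (simp only: add scaleR real_scaleR_def)
    finally show ?thesis using dx_dt_of_has_derivative[OF F'] by (simp add: algebra_simps)
  qed
  ultimately show ?thesis by (simp add: has_field_derivative_def)
qed

lemma dx_dt_det_p:
  assumes "p11 V differentiable (at z)" "p12 V differentiable (at z)" "p22 V differentiable (at z)"
  shows "det_p V differentiable (at z)"
    "dx (det_p V) z = p22 V z * dx (p11 V) z + p11 V z * dx (p22 V) z - 2 * p12 V z * dx (p12 V) z"
    "dt (det_p V) z = p22 V z * dt (p11 V) z + p11 V z * dt (p22 V) z - 2 * p12 V z * dt (p12 V) z"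
proof -
  obtain A B C where d: "(p11 V has_derivative A) (at z)" "(p12 V has_derivative B) (at z)"
      "(p22 V has_derivative C) (at z)"
    using assms by (auto simp: differentiable_def)
  have "(det_p V has_derivative (\<lambda>h. p22 V z * A h + p11 V z * C h - 2 * p12 V z * B h)) (at z)"
    unfolding det_p_def[abs_def] by (auto intro!: derivative_eq_intros d simp: algebra_simps)
  note det = this dx_dt_of_has_derivative[OF this]
  show "det_p V differentiable (at z)" using det(1) by (auto simp: differentiable_def)
  show "dx (det_p V) z = p22 V z * dx (p11 V) z + p11 V z * dx (p22 V) z - 2 * p12 V z * dx (p12 V) z"
    "dt (det_p V) z = p22 V z * dt (p11 V) z + p11 V z * dt (p22 V) z - 2 * p12 V z * dt (p12 V) z"
    by (simp_all add: det(2,3) d[THEN dx_dt_of_has_derivative(1)] d[THEN dx_dt_of_has_derivative(2)])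
qed

section \<open>Traces on the boundary curve of a region\<close>

text \<open>
  The horizontal segments from the curve to some second smooth curve lie in the region; this is
  what makes it possible to push the curve into the region by a convex combination that is still
  differentiable in time. The two curves may be tangent at the origin, as is possible for the
  1-wave and the 2-shear curve, since every condition is imposed for positive times only.
\<close>

definition bounds_region :: "real \<Rightarrow> (real \<Rightarrow> real) \<Rightarrow> (real \<times> real) set \<Rightarrow> bool" where
  "bounds_region T y S \<longleftrightarrow> T > 0 \<and> smooth_curve T y \<and>
     (\<exists>b. smooth_curve T b \<and> (\<forall>t\<in>{0<..<T}. y t \<noteq> b t \<and>
        (\<forall>e\<in>{0<..<1}. (y t + e * (b t - y t), t) \<in> S)))"

lemma bounds_region_between:
  assumes "T > 0" "smooth_curve T a" "smooth_curve T b" "\<And>t. t \<in> {0<..<T} \<Longrightarrow> a t < b t"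
  shows "bounds_region T a (between T a b)" "bounds_region T b (between T a b)"
proof -
  have "(a t + e * (b t - a t), t) \<in> between T a b \<and> (b t + e * (a t - b t), t) \<in> between T a b"
    if "t \<in> {0<..<T}" "e \<in> {0<..<1}" for t e
  proof -
    have "0 < e * (b t - a t)" "0 < (1 - e) * (b t - a t)"
      using that assms(4)[OF that(1)] by auto
    then show ?thesis using that by (auto simp: between_def algebra_simps)
  qed
  then show "bounds_region T a (between T a b)" "bounds_region T b (between T a b)"
    using assms unfolding bounds_region_def by (metis less_irrefl)+
qed

lemma eventually_at_right_0_less: "T > 0 \<Longrightarrow> \<forall>\<^sub>F t in at_right 0. 0 < t \<and> t < (T::real)"
  unfolding eventually_at_right_field by blast

text \<open>
  The slope at the end point 0 is accessible only as the limit of \<open>deriv y\<close>: the two-sided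
  derivative \<open>deriv y 0\<close> also depends on the values of \<open>y\<close> at negative times.
\<close>

lemma smooth_curve_slope_at_0:
  assumes y: "smooth_curve T y" and T: "T > 0"
  obtains m where "(deriv y \<longlongrightarrow> m) (at_right 0)" "(y \<longlongrightarrow> 0) (at_right 0)"
    "\<And>t. t \<in> {0<..<T} \<Longrightarrow> (y has_real_derivative deriv y t) (at t)"
proof -
  obtain y' where c: "continuous_on {0..<T} y'" and y0: "y 0 = 0"
    and d: "\<And>t. t \<in> {0..<T} \<Longrightarrow> (y has_real_derivative y' t) (at t within {0..<T})"
    using y unfolding smooth_curve_def by blast
  have at0: "at 0 within {0..<T} = at_right 0"
    by (rule at_within_nhd[of _ "{..<T}"]) (use T in auto)
  have dy: "(y has_real_derivative y' t) (at t)" if "t \<in> {0<..<T}" for t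
    using d[of t] that at_within_open_subset[of t "{0<..<T}" "{0..<T}"] by force
  have "(y' \<longlongrightarrow> y' 0) (at_right 0)"
    using c T by (auto simp: continuous_on_def at0[symmetric])
  moreover have "\<forall>\<^sub>F t in at_right 0. y' t = deriv y t"
    using eventually_at_right_0_less[OF T]
    by eventually_elim (use dy DERIV_imp_deriv in force)
  ultimately have "(deriv y \<longlongrightarrow> y' 0) (at_right 0)" by (rule Lim_transform_eventually)
  moreover have "(y \<longlongrightarrow> 0) (at_right 0)"
    using DERIV_continuous[OF d[of 0]] T y0 by (auto simp: continuous_within at0)
  ultimately show ?thesis using that dy DERIV_imp_deriv by metis
qed

text \<open>
  The pushed-in curves are used in two limits: at a fixed time, as the push \<open>e\<close> vanishes, they
  reach the boundary curve; as time and push vanish independently, they reach the origin. The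
  second limit, taken in the product filter, supplies estimates that are uniform in \<open>e\<close>.
\<close>

lemma approach_through_region:
  assumes "bounds_region T y S"
  obtains b where "smooth_curve T b"
    "\<And>t e. t \<in> {0<..<T} \<Longrightarrow> e \<in> {0<..<1} \<Longrightarrow> (y t + e * (b t - y t), t) \<in> S"
    "\<And>t. t \<in> {0<..<T} \<Longrightarrow>
       filterlim (\<lambda>e. (y t + e * (b t - y t), t)) (at (y t, t) within S) (at_right 0)"
    "filterlim (\<lambda>(t, e). (y t + e * (b t - y t), t)) (at (0, 0) within S) (at_right 0 \<times>\<^sub>F at_right 0)"
proof -
  obtain b where T: "T > 0" and y: "smooth_curve T y" and b: "smooth_curve T b"
    and S: "\<And>t e. t \<in> {0<..<T} \<Longrightarrow> e \<in> {0<..<1} \<Longrightarrow> (y t + e * (b t - y t), t) \<in> S"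
    and ne: "\<And>t. t \<in> {0<..<T} \<Longrightarrow> y t \<noteq> b t"
    using assms unfolding bounds_region_def by blast
  have l: "(y \<longlongrightarrow> 0) (at_right 0)" "(b \<longlongrightarrow> 0) (at_right 0)"
    by (blast intro: smooth_curve_slope_at_0[OF y T] smooth_curve_slope_at_0[OF b T])+
  have fst0: "filterlim fst (at_right 0) (at_right (0::real) \<times>\<^sub>F at_right (0::real))"
    and snd0: "filterlim snd (at_right 0) (at_right (0::real) \<times>\<^sub>F at_right (0::real))"
    by (rule filterlim_fst filterlim_snd)+
  have id0: "((\<lambda>x. x) \<longlongrightarrow> 0) (at_right (0::real))" by (rule tendsto_ident_at)
  note lims = l[THEN filterlim_compose, OF fst0] id0[THEN filterlim_compose, OF fst0]
    id0[THEN filterlim_compose, OF snd0]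
  have "((\<lambda>p. (y (fst p) + snd p * (b (fst p) - y (fst p)), fst p)) \<longlongrightarrow> (0 + 0 * (0 - 0), 0))
    (at_right 0 \<times>\<^sub>F at_right 0)"
    by (intro tendsto_intros lims)
  moreover have "\<forall>\<^sub>F p in at_right 0 \<times>\<^sub>F at_right (0::real). (0 < fst p \<and> fst p < T) \<and> (0 < snd p \<and> snd p < 1)"
    using eventually_prodI[OF eventually_at_right_0_less[OF T] eventually_at_right_0_less[OF zero_less_one]]
    by simp
  then have "\<forall>\<^sub>F p in at_right 0 \<times>\<^sub>F at_right 0. (y (fst p) + snd p * (b (fst p) - y (fst p)), fst p) \<in> S
      \<and> (y (fst p) + snd p * (b (fst p) - y (fst p)), fst p) \<noteq> (0, 0)"
    by eventually_elim (use S in auto)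
  ultimately have 1: "filterlim (\<lambda>(t, e). (y t + e * (b t - y t), t)) (at (0, 0) within S)
      (at_right 0 \<times>\<^sub>F at_right 0)"
    by (simp add: filterlim_at case_prod_unfold)
  have 2: "filterlim (\<lambda>e. (y t + e * (b t - y t), t)) (at (y t, t) within S) (at_right 0)"
    if t: "t \<in> {0<..<T}" for t
  proof -
    have "((\<lambda>e. (y t + e * (b t - y t), t)) \<longlongrightarrow> (y t + 0 * (b t - y t), t)) (at_right 0)"
      by (intro tendsto_intros)
    moreover have "\<forall>\<^sub>F e in at_right 0. (y t + e * (b t - y t), t) \<in> S \<and> (y t + e * (b t - y t), t) \<noteq> (y t, t)"
      using eventually_at_right_0_less[OF zero_less_one]
      by eventually_elim (use S[OF t] ne[OF t] in auto)
    ultimately show ?thesis by (simp add: filterlim_at)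
  qed
  show ?thesis using that b S 1 2 by blast
qed

text \<open>
  Limits inside the region, at the origin and at the points of the curve, are unique.
\<close>

lemma bounds_region_nontrivial:
  assumes "bounds_region T y S"
  shows "at (0, 0) within S \<noteq> bot"
    "t \<in> {0<..<T} \<Longrightarrow> at (y t, t) within S \<noteq> bot"
proof -
  obtain b where b: 
    "\<And>t. t \<in> {0<..<T} \<Longrightarrow>
       filterlim (\<lambda>e. (y t + e * (b t - y t), t)) (at (y t, t) within S) (at_right 0)"
    "filterlim (\<lambda>(t, e). (y t + e * (b t - y t), t)) (at (0, 0) within S) (at_right 0 \<times>\<^sub>F at_right 0)"
    by (rule approach_through_region[OF assms]) (rule that)
  show "t \<in> {0<..<T} \<Longrightarrow> at (y t, t) within S \<noteq> bot" using b(1)[of t] 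
    by (auto simp: filterlim_def bot_unique filtermap_bot_iff)
  show "at (0, 0) within S \<noteq> bot" using b(2) 
    by (auto simp: filterlim_def bot_unique filtermap_bot_iff prod_filter_eq_bot)
qed

text \<open>
  The speed field converges at the origin, hence is close to its limit throughout a neighbourhood
  in the region, and so are the traces of the field at the nearby points of the curve. These
  traces are the slopes of the curve.
\<close>

lemma speed_at_origin:
  assumes S: "bounds_region T y S"
    and f0: "(f \<longlongrightarrow> a) (at (0, 0) within S)"
    and f: "\<And>t. t \<in> {0<..<T} \<Longrightarrow> (f \<longlongrightarrow> deriv y t) (at (y t, t) within S)"
  shows "(deriv y \<longlongrightarrow> a) (at_right 0)"
proof (rule tendstoI)
  fix \<eta> :: real assume "\<eta> > 0"
  have T: "T > 0" and "smooth_curve T y" using S by (auto simp: bounds_region_def)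
  then have y: "(y \<longlongrightarrow> 0) (at_right 0)" using smooth_curve_slope_at_0 by blast
  have "\<forall>\<^sub>F z in at (0, 0) within S. dist (f z) a < \<eta> / 2"
    using f0 \<open>\<eta> > 0\<close> by (intro tendstoD) auto
  then obtain U where U: "open U" "(0, 0) \<in> U"
    and fU: "\<And>z. z \<in> U \<Longrightarrow> z \<noteq> (0, 0) \<Longrightarrow> z \<in> S \<Longrightarrow> dist (f z) a < \<eta> / 2"
    unfolding eventually_at_topological by blast
  have "((\<lambda>t. (y t, t)) \<longlongrightarrow> (0, 0)) (at_right 0)" by (intro tendsto_intros y)
  then have "\<forall>\<^sub>F t in at_right 0. (y t, t) \<in> U" using U by (rule topological_tendstoD)
  with eventually_at_right_0_less[OF T] show "\<forall>\<^sub>F t in at_right 0. dist (deriv y t) a < \<eta>"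
  proof eventually_elim
    case (elim t)
    have "open (U - {(0, 0)})" "(y t, t) \<in> U - {(0, 0)}" using U elim by auto
    then have "\<forall>\<^sub>F z in at (y t, t) within S. dist (f z) a \<le> \<eta> / 2"
      unfolding eventually_at_topological using fU by (metis DiffD1 DiffD2 less_imp_le singletonI)
    moreover have "((\<lambda>z. dist (f z) a) \<longlongrightarrow> dist (deriv y t) a) (at (y t, t) within S)"
      using f elim by (intro tendsto_intros) auto
    ultimately have "dist (deriv y t) a \<le> \<eta> / 2"
      using bounds_region_nontrivial(2)[OF S] elim tendsto_upperbound by (metis greaterThanLessThan_iff)
    with \<open>\<eta> > 0\<close> show ?case by simp
  qed
qed

text \<open>
  On a curve pushed into the region by a fixed \<open>e\<close>, the increment of \<open>F\<close> is given by the mean value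
  theorem. The derivative of \<open>F\<close> along that curve is close to \<open>Y + m * X\<close> for small times and small
  \<open>e\<close>, so the error is at most \<open>\<eta> * (t - s)\<close> with a bound on \<open>t\<close> that does not depend on \<open>e\<close>.
  Letting \<open>e\<close> tend to 0 turns the values of \<open>F\<close> into traces.
\<close>

lemma trace_increment:
  assumes S: "bounds_region T y S"
    and F: "\<forall>z\<in>S. F differentiable (at z)"
    and Fx: "(dx F \<longlongrightarrow> X) (at (0, 0) within S)" and Ft: "(dt F \<longlongrightarrow> Y) (at (0, 0) within S)"
    and m: "(deriv y \<longlongrightarrow> m) (at_right 0)"
    and \<eta>: "\<eta> > 0"
  shows "\<forall>\<^sub>F t in at_right 0. \<forall>s\<in>{0<..<t}. \<forall>k l.
    (F \<longlongrightarrow> k) (at (y s, s) within S) \<longrightarrow> (F \<longlongrightarrow> l) (at (y t, t) within S) \<longrightarrow>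
    \<bar>l - k - (t - s) * (Y + m * X)\<bar> \<le> \<eta> * (t - s)"
proof -
  have T: "T > 0" and y: "smooth_curve T y" using S by (auto simp: bounds_region_def)
  obtain b where b: "smooth_curve T b"
    and bS: "\<And>t e. t \<in> {0<..<T} \<Longrightarrow> e \<in> {0<..<1} \<Longrightarrow> (y t + e * (b t - y t), t) \<in> S"
    and trace: "\<And>t. t \<in> {0<..<T} \<Longrightarrow>
       filterlim (\<lambda>e. (y t + e * (b t - y t), t)) (at (y t, t) within S) (at_right 0)"
    and origin: "filterlim (\<lambda>(t, e). (y t + e * (b t - y t), t)) (at (0, 0) within S)
       (at_right 0 \<times>\<^sub>F at_right 0)"
    by (rule approach_through_region[OF S]) (rule that)
  have dy: "\<And>t. t \<in> {0<..<T} \<Longrightarrow> (y has_real_derivative deriv y t) (at t)"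
    by (blast intro: smooth_curve_slope_at_0[OF y T])
  obtain n where n: "(deriv b \<longlongrightarrow> n) (at_right 0)"
    and db: "\<And>t. t \<in> {0<..<T} \<Longrightarrow> (b has_real_derivative deriv b t) (at t)"
    by (rule smooth_curve_slope_at_0[OF b T]) (rule that)
  \<comment> \<open>\<open>\<gamma> e\<close> is the boundary curve pushed in by \<open>e\<close>, \<open>\<gamma>' e\<close> its slope and \<open>G e\<close> the
    derivative of \<open>F\<close> along it.\<close>
  define \<gamma> where "\<gamma> e t = y t + e * (b t - y t)" for e t
  define \<gamma>' where "\<gamma>' e t = deriv y t + e * (deriv b t - deriv y t)" for e t
  define G where "G e t = dt F (\<gamma> e t, t) + \<gamma>' e t * dx F (\<gamma> e t, t)" for e t
  have fst0: "filterlim fst (at_right 0) (at_right (0::real) \<times>\<^sub>F at_right (0::real))"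
    and snd0: "filterlim snd (at_right 0) (at_right (0::real) \<times>\<^sub>F at_right (0::real))"
    by (rule filterlim_fst filterlim_snd)+
  have id0: "((\<lambda>x. x) \<longlongrightarrow> 0) (at_right (0::real))" by (rule tendsto_ident_at)
  note lims = m[THEN filterlim_compose, OF fst0] n[THEN filterlim_compose, OF fst0]
    id0[THEN filterlim_compose, OF snd0]
    Fx[THEN filterlim_compose, OF origin] Ft[THEN filterlim_compose, OF origin]
  have "((\<lambda>p. G (snd p) (fst p)) \<longlongrightarrow> Y + (m + 0 * (n - m)) * X) (at_right 0 \<times>\<^sub>F at_right 0)"
    unfolding G_def \<gamma>'_def \<gamma>_def
    by (intro tendsto_intros lims lims[unfolded case_prod_unfold])
  then have "\<forall>\<^sub>F p in at_right 0 \<times>\<^sub>F at_right 0. dist (G (snd p) (fst p)) (Y + m * X) < \<eta>"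
    using \<eta> by (auto dest: tendstoD)
  then obtain P Q where P: "eventually P (at_right 0)" and Q: "eventually Q (at_right 0)"
    and PQ: "\<And>s e. P s \<Longrightarrow> Q e \<Longrightarrow> \<bar>G e s - (Y + m * X)\<bar> < \<eta>"
    unfolding eventually_prod_filter dist_real_def by auto
  from P obtain \<delta> where \<delta>: "\<delta> > 0" "\<And>s. 0 < s \<Longrightarrow> s < \<delta> \<Longrightarrow> P s"
    unfolding eventually_at_right_field by auto
  from eventually_at_right_0_less[OF T] eventually_at_right_0_less[OF \<delta>(1)] show ?thesis
  proof (eventually_elim, intro ballI allI impI)
    fix t s k l
    assume t: "0 < t \<and> t < T" "0 < t \<and> t < \<delta>" and s: "s \<in> {0<..<t}"
      and k: "(F \<longlongrightarrow> k) (at (y s, s) within S)" and l: "(F \<longlongrightarrow> l) (at (y t, t) within S)"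
    have "\<forall>\<^sub>F e in at_right 0.
      \<bar>F (\<gamma> e t, t) - F (\<gamma> e s, s) - (t - s) * (Y + m * X)\<bar> \<le> \<eta> * (t - s)"
      using Q eventually_at_right_0_less[OF zero_less_one]
    proof eventually_elim
      case (elim e)
      have "((\<lambda>r. F (\<gamma> e r, r)) has_real_derivative G e r) (at r)" if "s \<le> r" "r \<le> t" for r
      proof -
        have r: "r \<in> {0<..<T}" using that s t by auto
        have "(\<gamma> e has_real_derivative \<gamma>' e r) (at r)"
          unfolding \<gamma>_def \<gamma>'_def by (auto intro!: derivative_eq_intros dy[OF r] db[OF r])
        moreover have "F differentiable (at (\<gamma> e r, r))"
          using F bS[OF r, of e] elim by (auto simp: \<gamma>_def)
        ultimately show ?thesis unfolding G_def by (rule has_derivative_along_curve[rotated])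
      qed
      then obtain r where r: "s < r" "r < t" "F (\<gamma> e t, t) - F (\<gamma> e s, s) = (t - s) * G e r"
        using MVT2[of s t "\<lambda>r. F (\<gamma> e r, r)" "G e"] s by auto
      have "\<bar>F (\<gamma> e t, t) - F (\<gamma> e s, s) - (t - s) * (Y + m * X)\<bar> = (t - s) * \<bar>G e r - (Y + m * X)\<bar>"
        using s unfolding r(3) by (simp add: abs_mult flip: right_diff_distrib)
      also have "\<dots> \<le> (t - s) * \<eta>"
        using PQ[of r e] \<delta>(2)[of r] r s t elim by (intro mult_left_mono) auto
      finally show ?case by (simp add: mult.commute)
    qed
    moreover have "((\<lambda>e. \<bar>F (\<gamma> e t, t) - F (\<gamma> e s, s) - (t - s) * (Y + m * X)\<bar>) \<longlongrightarrow>
        \<bar>l - k - (t - s) * (Y + m * X)\<bar>) (at_right 0)"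
      unfolding \<gamma>_def using s t
      by (intro tendsto_intros filterlim_compose[OF k] filterlim_compose[OF l] trace) auto
    ultimately show "\<bar>l - k - (t - s) * (Y + m * X)\<bar> \<le> \<eta> * (t - s)"
      by (intro tendsto_upperbound[where F = "at_right (0::real)"]) auto
  qed
qed

text \<open>
  Both \<open>Y + m * X\<close> and \<open>Y' + m * X'\<close> approximate the same difference quotient of the common
  trace, here taken between \<open>t/2\<close> and \<open>t\<close>, with an error that is arbitrarily small for small \<open>t\<close>.
\<close>

lemma derivative_along_curve_agrees:
  assumes S: "bounds_region T y S" "bounds_region T y S'"
    and F: "\<forall>z\<in>S. F differentiable (at z)" "\<forall>z\<in>S'. F differentiable (at z)"
    and l: "(dx F \<longlongrightarrow> X) (at (0, 0) within S)" "(dt F \<longlongrightarrow> Y) (at (0, 0) within S)"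
    and l': "(dx F \<longlongrightarrow> X') (at (0, 0) within S')" "(dt F \<longlongrightarrow> Y') (at (0, 0) within S')"
    and m: "(deriv y \<longlongrightarrow> m) (at_right 0)"
    and c: "continuous_along T y S S' F"
  shows "Y + m * X = Y' + m * X'"
proof -
  let ?d = "\<bar>(Y + m * X) - (Y' + m * X')\<bar>"
  have "?d \<le> 0 + \<epsilon>" if \<epsilon>: "\<epsilon> > 0" for \<epsilon>
  proof -
    have \<eta>: "\<epsilon> / 2 > 0" and T: "T > 0" using \<epsilon> S by (auto simp: bounds_region_def)
    from eventually_happens'[OF trivial_limit_at_right_real
        eventually_conj[OF eventually_at_right_0_less[OF T]
          eventually_conj[OF trace_increment[OF S(1) F(1) l m \<eta>] trace_increment[OF S(2) F(2) l' m \<eta>]]]]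
    obtain t where t: "0 < t" "t < T"
      and incr: "\<forall>s\<in>{0<..<t}. \<forall>k j. (F \<longlongrightarrow> k) (at (y s, s) within S) \<longrightarrow>
          (F \<longlongrightarrow> j) (at (y t, t) within S) \<longrightarrow> \<bar>j - k - (t - s) * (Y + m * X)\<bar> \<le> \<epsilon>/2 * (t - s)"
        "\<forall>s\<in>{0<..<t}. \<forall>k j. (F \<longlongrightarrow> k) (at (y s, s) within S') \<longrightarrow>
          (F \<longlongrightarrow> j) (at (y t, t) within S') \<longrightarrow> \<bar>j - k - (t - s) * (Y' + m * X')\<bar> \<le> \<epsilon>/2 * (t - s)"
      by blast
    have s: "t/2 \<in> {0<..<t}" and sT: "t/2 \<in> {0<..<T}" "t \<in> {0<..<T}" using t by auto
    obtain k where k: "(F \<longlongrightarrow> k) (at (y (t/2), t/2) within S)" "(F \<longlongrightarrow> k) (at (y (t/2), t/2) within S')"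
      using c sT(1) unfolding continuous_along_def by blast
    obtain j where j: "(F \<longlongrightarrow> j) (at (y t, t) within S)" "(F \<longlongrightarrow> j) (at (y t, t) within S')"
      using c sT(2) unfolding continuous_along_def by blast
    have "\<bar>j - k - (t - t/2) * (Y + m * X)\<bar> \<le> \<epsilon>/2 * (t - t/2)"
      "\<bar>j - k - (t - t/2) * (Y' + m * X')\<bar> \<le> \<epsilon>/2 * (t - t/2)"
      using incr s k j by blast+
    then have "\<bar>(t - t/2) * (Y + m * X) - (t - t/2) * (Y' + m * X')\<bar> \<le> (t - t/2) * \<epsilon>" by argo
    moreover have "\<bar>(t - t/2) * (Y + m * X) - (t - t/2) * (Y' + m * X')\<bar> = (t - t/2) * ?d"
      unfolding right_diff_distrib[symmetric] abs_mult using t by simp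
    ultimately have "(t - t/2) * ?d \<le> (t - t/2) * \<epsilon>" by (simp only:)
    then show ?thesis using t by simp
  qed
  then have "?d \<le> 0" by (rule field_le_epsilon)
  then show ?thesis by simp
qed

section \<open>The flow and its equations at the origin\<close>

lemma origin_limits:
  assumes "has_origin_limits V S" "at (0, 0) within S \<noteq> bot" "F \<in> components V"
  shows "(F \<longlongrightarrow> lim0 S F) (at (0, 0) within S)"
    "(dx F \<longlongrightarrow> lim0 S (dx F)) (at (0, 0) within S)"
    "(dt F \<longlongrightarrow> lim0 S (dt F)) (at (0, 0) within S)"
  using assms unfolding has_origin_limits_def lim0_def by (metis insertI1 insertI2 tendsto_Lim)+

lemma lim0_D:
  assumes "has_origin_limits V S" "at (0, 0) within S \<noteq> bot" "F \<in> components V"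
    and "(a \<longlongrightarrow> \<alpha>) (at (0, 0) within S)"
  shows "lim0 S (D a F) = lim0 S (dt F) + \<alpha> * lim0 S (dx F)"
    "(D a F \<longlongrightarrow> lim0 S (D a F)) (at (0, 0) within S)"
proof -
  have lim: "(D a F \<longlongrightarrow> lim0 S (dt F) + \<alpha> * lim0 S (dx F)) (at (0, 0) within S)"
    unfolding D_def[abs_def] by (intro assms tendsto_intros origin_limits[OF assms(1-3)])
  from tendsto_Lim[OF assms(2) this]
  show eq: "lim0 S (D a F) = lim0 S (dt F) + \<alpha> * lim0 S (dx F)" by (simp only: lim0_def)
  show "(D a F \<longlongrightarrow> lim0 S (D a F)) (at (0, 0) within S)" using lim unfolding eq .
qed

lemma tendsto_within_cong:
  assumes "(g \<longlongrightarrow> l) (at a within S)" "\<And>z. z \<in> S \<Longrightarrow> f z = g z"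
  shows "(f \<longlongrightarrow> l) (at a within S)"
  using assms by (subst Lim_cong_within[where g = g]) auto

lemma components_mem [simp]:
  "rho V \<in> components V" "u1 V \<in> components V" "u2 V \<in> components V"
  "p11 V \<in> components V" "p12 V \<in> components V" "p22 V \<in> components V"
  by (auto simp: components_def)

text \<open>
  The equations pass to the limit because all fields and their first derivatives converge. The
  second formula eliminates \<open>dx (u1 V)\<close> and \<open>dx (u2 V)\<close> from the equation for \<open>p22\<close> by means of
  those for \<open>p11\<close> and \<open>p12\<close>.
\<close>

lemma equations_at_origin:
  assumes sol: "smooth_solution_on W V S" and lim: "has_origin_limits V S"
    and nb: "at (0, 0) within S \<noteq> bot"
    and st: "lim_state V S = (r, u, v, p, q, s)" and pos: "r > 0" "p > 0"
  shows "lim0 S (D (u1 V) (u2 V)) = - lim0 S (dx (p12 V)) / r"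
    "lim0 S (D (u1 V) (p22 V)) =
       (p * s - 4 * q\<^sup>2) / (3 * p\<^sup>2) * lim0 S (D (u1 V) (p11 V)) + 2 * q / p * lim0 S (D (u1 V) (p12 V))"
proof -
  note l = origin_limits[OF lim nb]
  have st': "lim0 S (rho V) = r" "lim0 S (u1 V) = u" "lim0 S (p11 V) = p" "lim0 S (p12 V) = q" "lim0 S (p22 V) = s"
    using st by (auto simp: lim_state_def)
  have zero: "k = 0" if "(f \<longlongrightarrow> k) (at (0, 0) within S)" "\<And>z. z \<in> S \<Longrightarrow> f z = 0" for f and k :: real
  proof -
    have "((\<lambda>_. 0) \<longlongrightarrow> k) (at (0, 0) within S)"
      by (rule tendsto_within_cong[OF that(1)]) (simp add: that(2))
    then show ?thesis using nb by (simp add: tendsto_const_iff)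
  qed
  have eqs: "ten_moment_equations W V z" if "z \<in> S" for z
    using sol that by (auto simp: smooth_solution_on_def)
  have tD: "(D (u1 V) F \<longlongrightarrow> lim0 S (D (u1 V) F)) (at (0, 0) within S)" if "F \<in> components V" for F
    by (rule lim0_D(2)[OF lim nb that l(1)]) simp
  have lp: "(rho V \<longlongrightarrow> r) (at (0, 0) within S)" "(p11 V \<longlongrightarrow> p) (at (0, 0) within S)"
      "(p12 V \<longlongrightarrow> q) (at (0, 0) within S)" "(p22 V \<longlongrightarrow> s) (at (0, 0) within S)"
    using l(1)[of "rho V"] l(1)[of "p11 V"] l(1)[of "p12 V"] l(1)[of "p22 V"] st' by auto
  have "r \<noteq> 0" using pos by simp
  note lims = tD l(2) lp this components_mem
  have e1: "lim0 S (D (u1 V) (u2 V)) + 1 / r * lim0 S (dx (p12 V)) = 0"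
  proof (rule zero)
    show "((\<lambda>z. D (u1 V) (u2 V) z + 1 / rho V z * dx (p12 V) z) \<longlongrightarrow>
        lim0 S (D (u1 V) (u2 V)) + 1 / r * lim0 S (dx (p12 V))) (at (0, 0) within S)"
      by (intro tendsto_intros lims)
  qed (use eqs in \<open>simp add: ten_moment_equations_def\<close>)
  then show "lim0 S (D (u1 V) (u2 V)) = - lim0 S (dx (p12 V)) / r" by (simp add: add_eq_0_iff)
  have e2: "lim0 S (D (u1 V) (p11 V)) + 3 * p * lim0 S (dx (u1 V)) = 0"
  proof (rule zero)
    show "((\<lambda>z. D (u1 V) (p11 V) z + 3 * p11 V z * dx (u1 V) z) \<longlongrightarrow>
        lim0 S (D (u1 V) (p11 V)) + 3 * p * lim0 S (dx (u1 V))) (at (0, 0) within S)"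
      by (intro tendsto_intros lims)
  qed (use eqs in \<open>simp add: ten_moment_equations_def\<close>)
  have e3: "lim0 S (D (u1 V) (p12 V)) + 2 * q * lim0 S (dx (u1 V)) + p * lim0 S (dx (u2 V)) = 0"
  proof (rule zero)
    show "((\<lambda>z. D (u1 V) (p12 V) z + 2 * p12 V z * dx (u1 V) z + p11 V z * dx (u2 V) z) \<longlongrightarrow>
        lim0 S (D (u1 V) (p12 V)) + 2 * q * lim0 S (dx (u1 V)) + p * lim0 S (dx (u2 V)))
        (at (0, 0) within S)"
      by (intro tendsto_intros lims)
  qed (use eqs in \<open>simp add: ten_moment_equations_def\<close>)
  have e4: "lim0 S (D (u1 V) (p22 V)) + s * lim0 S (dx (u1 V)) + 2 * q * lim0 S (dx (u2 V)) = 0"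
  proof (rule zero)
    show "((\<lambda>z. D (u1 V) (p22 V) z + p22 V z * dx (u1 V) z + 2 * p12 V z * dx (u2 V) z) \<longlongrightarrow>
        lim0 S (D (u1 V) (p22 V)) + s * lim0 S (dx (u1 V)) + 2 * q * lim0 S (dx (u2 V)))
        (at (0, 0) within S)"
      by (intro tendsto_intros lims)
  qed (use eqs in \<open>simp add: ten_moment_equations_def\<close>)
  have "3 * p\<^sup>2 * lim0 S (D (u1 V) (p22 V)) =
      (p * s - 4 * q\<^sup>2) * lim0 S (D (u1 V) (p11 V)) + 6 * p * q * lim0 S (D (u1 V) (p12 V))"
    using e2 e3 e4 by algebra
  then show "lim0 S (D (u1 V) (p22 V)) =
       (p * s - 4 * q\<^sup>2) / (3 * p\<^sup>2) * lim0 S (D (u1 V) (p11 V)) + 2 * q / p * lim0 S (D (u1 V) (p12 V))"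
    using pos by (simp add: field_simps power2_eq_square)
qed

lemma det_p_origin_limits:
  assumes sol: "smooth_solution_on W V S" and lim: "has_origin_limits V S"
    and nb: "at (0, 0) within S \<noteq> bot"
  shows "\<forall>z\<in>S. det_p V differentiable (at z)"
    "(dx (det_p V) \<longlongrightarrow> lim0 S (p22 V) * lim0 S (dx (p11 V)) + lim0 S (p11 V) * lim0 S (dx (p22 V))
       - 2 * lim0 S (p12 V) * lim0 S (dx (p12 V))) (at (0, 0) within S)"
    "(dt (det_p V) \<longlongrightarrow> lim0 S (p22 V) * lim0 S (dt (p11 V)) + lim0 S (p11 V) * lim0 S (dt (p22 V))
       - 2 * lim0 S (p12 V) * lim0 S (dt (p12 V))) (at (0, 0) within S)"
proof -
  have diff: "p11 V differentiable (at z)" "p12 V differentiable (at z)" "p22 V differentiable (at z)"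
    if "z \<in> S" for z
    using sol that by (auto simp: smooth_solution_on_def C1_on_def)
  note det = dx_dt_det_p[OF diff]
  show "\<forall>z\<in>S. det_p V differentiable (at z)" using det(1) by blast
  show "(dx (det_p V) \<longlongrightarrow> lim0 S (p22 V) * lim0 S (dx (p11 V)) + lim0 S (p11 V) * lim0 S (dx (p22 V))
       - 2 * lim0 S (p12 V) * lim0 S (dx (p12 V))) (at (0, 0) within S)"
    by (rule tendsto_within_cong[OF _ det(2)])
      (intro tendsto_intros origin_limits[OF lim nb] components_mem)
  show "(dt (det_p V) \<longlongrightarrow> lim0 S (p22 V) * lim0 S (dt (p11 V)) + lim0 S (p11 V) * lim0 S (dt (p22 V))
       - 2 * lim0 S (p12 V) * lim0 S (dt (p12 V))) (at (0, 0) within S)"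
    by (rule tendsto_within_cong[OF _ det(3)])
      (intro tendsto_intros origin_limits[OF lim nb] components_mem)
qed

section \<open>Crossing a shear curve\<close>

text \<open>
  The derivatives along the curve of \<open>det_p V\<close> and of \<open>p11 V\<close> agree on both sides; the claim is the
  product rule for the former, with the latter used to write both derivatives of \<open>p11 V\<close> as the one
  in \<open>S\<close>.
\<close>

lemma derivative_along_shear:
  assumes S: "bounds_region T y S" "bounds_region T y S'"
    and sol: "smooth_solution_on W V S" "smooth_solution_on W V S'"
    and lim: "has_origin_limits V S" "has_origin_limits V S'"
    and st: "lim_state V S = (r, u, v, p, q, s)" "lim_state V S' = (r', u, v', p, q', s')"
    and m: "(deriv y \<longlongrightarrow> m) (at_right 0)"
    and c: "continuous_along T y S S' (p11 V)" "continuous_along T y S S' (det_p V)"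
  shows "p * (lim0 S' (D (\<lambda>_. m) (p22 V)) - lim0 S (D (\<lambda>_. m) (p22 V)))
    = (s - s') * lim0 S (D (\<lambda>_. m) (p11 V))
      - 2 * q * lim0 S (D (\<lambda>_. m) (p12 V)) + 2 * q' * lim0 S' (D (\<lambda>_. m) (p12 V))"
proof -
  note nb = S[THEN bounds_region_nontrivial(1)]
  note l = origin_limits[OF lim(1) nb(1)] and l' = origin_limits[OF lim(2) nb(2)]
  note D = lim0_D(1)[OF lim(1) nb(1) _ tendsto_const] lim0_D(1)[OF lim(2) nb(2) _ tendsto_const]
  have F: "\<forall>z\<in>S. F differentiable (at z)" "\<forall>z\<in>S'. F differentiable (at z)" if "F \<in> components V" for F
    using sol that unfolding smooth_solution_on_def C1_on_def by blast+
  have st': "lim0 S (p11 V) = p" "lim0 S (p12 V) = q" "lim0 S (p22 V) = s"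
    "lim0 S' (p11 V) = p" "lim0 S' (p12 V) = q'" "lim0 S' (p22 V) = s'"
    using st by (auto simp: lim_state_def)
  note det = det_p_origin_limits[OF sol(1) lim(1) nb(1)] det_p_origin_limits[OF sol(2) lim(2) nb(2)]
  have A: "lim0 S (D (\<lambda>_. m) (p11 V)) = lim0 S' (D (\<lambda>_. m) (p11 V))"
    unfolding D[OF components_mem(4)]
    by (rule derivative_along_curve_agrees[OF S F[OF components_mem(4)] l(2,3) l'(2,3) m c(1)]) simp_all
  have B: "s * lim0 S (D (\<lambda>_. m) (p11 V)) + p * lim0 S (D (\<lambda>_. m) (p22 V)) - 2 * q * lim0 S (D (\<lambda>_. m) (p12 V))
    = s' * lim0 S' (D (\<lambda>_. m) (p11 V)) + p * lim0 S' (D (\<lambda>_. m) (p22 V)) - 2 * q' * lim0 S' (D (\<lambda>_. m) (p12 V))"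
    using derivative_along_curve_agrees[OF S det(1,4,2,3,5,6) m c(2)]
    by (simp add: D st' algebra_simps)
  show ?thesis using A B by (simp add: algebra_simps)
qed

text \<open>
  Multiplying the preceding identity by \<open>u\<close> removes the space derivatives, because
  \<open>u * (dt F + m * dx F) = (u - m) * dt F + m * (dt F + u * dx F)\<close> and the last bracket is the
  material derivative.
\<close>

lemma dt_p22_across_shear:
  assumes S: "bounds_region T y S" "bounds_region T y S'"
    and sol: "smooth_solution_on W V S" "smooth_solution_on W V S'"
    and lim: "has_origin_limits V S" "has_origin_limits V S'"
    and st: "lim_state V S = (r, u, v, p, q, s)" "lim_state V S' = (r', u, v', p, q', s')"
    and pos: "r > 0" "r' > 0" "p > 0"
    and m: "(deriv y \<longlongrightarrow> m) (at_right 0)"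
    and c: "continuous_along T y S S' (p11 V)" "continuous_along T y S S' (det_p V)"
    and Dp11: "lim0 S (D (u1 V) (p11 V)) = a" "lim0 S' (D (u1 V) (p11 V)) = a"
  shows "p * (u - m) * lim0 S' (dt (p22 V)) =
    u * ((s - s') * lim0 S (D (\<lambda>_. m) (p11 V))
         - 2 * q * lim0 S (D (\<lambda>_. m) (p12 V)) + 2 * q' * lim0 S' (D (\<lambda>_. m) (p12 V)))
    + p * ((u - m) * lim0 S (dt (p22 V))
         + m / (3 * p\<^sup>2) * (p * s - 4 * q\<^sup>2 - p * s' + 4 * q'\<^sup>2) * a
         + 2 * m / p * (q * lim0 S (D (u1 V) (p12 V)) - q' * lim0 S' (D (u1 V) (p12 V))))"
proof -
  note nb = S[THEN bounds_region_nontrivial(1)]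
  have u: "(u1 V \<longlongrightarrow> u) (at (0, 0) within S)" "(u1 V \<longlongrightarrow> u) (at (0, 0) within S')"
    using origin_limits(1)[OF lim(1) nb(1), of "u1 V"] origin_limits(1)[OF lim(2) nb(2), of "u1 V"] st
    by (auto simp: lim_state_def)
  note D = lim0_D(1)[OF lim(1) nb(1) components_mem(6) tendsto_const, of m]
    lim0_D(1)[OF lim(2) nb(2) components_mem(6) tendsto_const, of m]
  note Du = lim0_D(1)[OF lim(1) nb(1) components_mem(6) u(1)] lim0_D(1)[OF lim(2) nb(2) components_mem(6) u(2)]
  have comb: "u * lim0 S (D (\<lambda>_. m) (p22 V)) = (u - m) * lim0 S (dt (p22 V)) + m * lim0 S (D (u1 V) (p22 V))"
    "u * lim0 S' (D (\<lambda>_. m) (p22 V)) = (u - m) * lim0 S' (dt (p22 V)) + m * lim0 S' (D (u1 V) (p22 V))"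
    unfolding D Du by algebra+
  have mat: "m * (lim0 S (D (u1 V) (p22 V)) - lim0 S' (D (u1 V) (p22 V))) =
      m / (3 * p\<^sup>2) * (p * s - 4 * q\<^sup>2 - p * s' + 4 * q'\<^sup>2) * a
      + 2 * m / p * (q * lim0 S (D (u1 V) (p12 V)) - q' * lim0 S' (D (u1 V) (p12 V)))"
    unfolding equations_at_origin(2)[OF sol(1) lim(1) nb(1) st(1) pos(1,3)]
      equations_at_origin(2)[OF sol(2) lim(2) nb(2) st(2) pos(2,3)] Dp11
    using pos(3) by (simp add: field_simps)
  have "p * (u - m) * lim0 S' (dt (p22 V)) =
      u * (p * (lim0 S' (D (\<lambda>_. m) (p22 V)) - lim0 S (D (\<lambda>_. m) (p22 V))))
      + p * ((u - m) * lim0 S (dt (p22 V)) + m * (lim0 S (D (u1 V) (p22 V)) - lim0 S' (D (u1 V) (p22 V))))"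
    using comb by algebra
  then show ?thesis
    unfolding derivative_along_shear[OF S sol lim st m c] mat by (simp add: add.assoc)
qed

theorem theorem5p21:
  fixes W :: "real \<Rightarrow> real" and V :: flow and w :: waves and T X :: real
    and rho_s u2_s p12_s p22_s p22_ss c_s lam :: "side \<Rightarrow> real"
    and u1_s p11_s u2_ss p12_ss :: real
    and Du1_s Dp11_s Du2_ss Dp12_ss :: real
    and g f f_tilde f_hat :: "side \<Rightarrow> real"
  assumes "grp_solution W V w T X"
    and "nonsonic w T"
    and "\<And>K. lim_state V (star w T K) = (rho_s K, u1_s, u2_s K, p11_s, p12_s K, p22_s K)"
    and "\<And>K. lim_state V (sstar w T K) = (rho_s K, u1_s, u2_ss, p11_s, p12_ss, p22_ss K)"
    and "\<And>K. lim0 (star w T K) (D (u1 V) (u1 V)) = Du1_s"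
    and "\<And>K. lim0 (sstar w T K) (D (u1 V) (u1 V)) = Du1_s"
    and "\<And>K. lim0 (star w T K) (D (u1 V) (p11 V)) = Dp11_s"
    and "\<And>K. lim0 (sstar w T K) (D (u1 V) (p11 V)) = Dp11_s"
    and "\<And>K. lim0 (sstar w T K) (D (u1 V) (u2 V)) = Du2_ss"
    and "\<And>K. lim0 (sstar w T K) (D (u1 V) (p12 V)) = Dp12_ss"
    and "\<And>K. c_s K = sqrt (3 * p11_s / rho_s K)"
    and "lam L = u1_s - c_s L / sqrt 3"
    and "lam R = u1_s + c_s R / sqrt 3"
    and "lam L < 0" and "lam R > 0"
    and "\<And>K. g K = p11_s * (u1_s - lam K)"
    and "\<And>K. f_tilde K =
           (p22_s K - p22_ss K) * lim0 (star w T K) (D (\<lambda>_. lam K) (p11 V))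
           - 2 * p12_s K * lim0 (star w T K) (D (\<lambda>_. lam K) (p12 V))
           + 2 * p12_ss * lim0 (sstar w T K) (D (\<lambda>_. lam K) (p12 V))"
    and "\<And>K. f_hat K =
           (u1_s - lam K) * lim0 (star w T K) (dt (p22 V))
           + lam K / (3 * p11_s\<^sup>2)
             * (p11_s * p22_s K - 4 * (p12_s K)\<^sup>2 - p11_s * p22_ss K + 4 * p12_ss\<^sup>2) * Dp11_s
           + 2 * lam K / p11_s
             * (p12_s K * lim0 (star w T K) (D (u1 V) (p12 V)) - p12_ss * Dp12_ss)"
    and "\<And>K. f K = u1_s * f_tilde K + p11_s * f_hat K"
  shows "(\<forall>K. g K * lim0 (sstar w T K) (dt (p22 V)) = f K) \<and>
         lim0 (sstar w T R) (D (\<lambda>_. lam R) (p12 V))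
           = Dp12_ss - rho_s R * (lam R - u1_s) * Du2_ss"
proof -
  note sol = assms(1)[unfolded grp_solution_def]
  have order: "x1r w t < x2 w t" "x2 w t < xc w t" "xc w t < x5 w t" "x5 w t < x6l w t"
    if "t \<in> {0<..<T}" for t
    using sol that by auto
  have "T > 0" and curves: "smooth_curve T (x1r w)" "smooth_curve T (x2 w)" "smooth_curve T (xc w)"
      "smooth_curve T (x5 w)" "smooth_curve T (x6l w)"
    using sol by auto
  have regions: "bounds_region T (x2 w) (star w T L)" "bounds_region T (x2 w) (sstar w T L)"
      "bounds_region T (x5 w) (star w T R)" "bounds_region T (x5 w) (sstar w T R)"
    using order curves \<open>T > 0\<close> by (auto intro!: bounds_region_between)
  have smooth: "smooth_solution_on W V (star w T K)" "smooth_solution_on W V (sstar w T K)" for K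
    using sol by auto
  have lims: "has_origin_limits V (star w T K)" "has_origin_limits V (sstar w T K)" for K
    using sol by auto
  have "admissible (lim_state V (star w T K))" for K using sol by blast
  then have pos: "rho_s K > 0" "p11_s > 0" for K
    unfolding assms(3) by (auto simp: admissible_def)
  have shear: "moves_with_speed T (x2 w) (star w T L) (sstar w T L) (\<lambda>z. u1 V z - c V z / sqrt 3)"
     "moves_with_speed T (x5 w) (sstar w T R) (star w T R) (\<lambda>z. u1 V z + c V z / sqrt 3)"
     "continuous_along T (x2 w) (star w T L) (sstar w T L) (p11 V)"
     "continuous_along T (x2 w) (star w T L) (sstar w T L) (det_p V)"
     "continuous_along T (x5 w) (star w T R) (sstar w T R) (p11 V)"
     "continuous_along T (x5 w) (star w T R) (sstar w T R) (det_p V)"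
    using sol unfolding shear_2_def shear_5_def continuous_along_def by blast+
  have nb: "at (0, 0) within star w T K \<noteq> bot" "at (0, 0) within sstar w T K \<noteq> bot" for K
    using regions[THEN bounds_region_nontrivial(1)] by (cases K; simp)+
  have state: "(rho V \<longlongrightarrow> rho_s K) (at (0, 0) within star w T K)"
    "(u1 V \<longlongrightarrow> u1_s) (at (0, 0) within star w T K)"
    "(p11 V \<longlongrightarrow> p11_s) (at (0, 0) within star w T K)" for K
    using origin_limits(1)[OF lims(1)[of K] nb(1)[of K] components_mem(1)]
      origin_limits(1)[OF lims(1)[of K] nb(1)[of K] components_mem(2)]
      origin_limits(1)[OF lims(1)[of K] nb(1)[of K] components_mem(4)] assms(3)[of K]
    by (simp_all add: lim_state_def)
  have c: "(c V \<longlongrightarrow> c_s K) (at (0, 0) within star w T K)" for K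
    unfolding c_def[abs_def] assms(11) using pos(1)[of K] by (intro tendsto_intros state) auto
  have m2: "(deriv (x2 w) \<longlongrightarrow> lam L) (at_right 0)"
  proof (rule speed_at_origin[OF regions(1)])
    show "((\<lambda>z. u1 V z - c V z / sqrt 3) \<longlongrightarrow> lam L) (at (0, 0) within star w T L)"
      unfolding assms(12) by (intro tendsto_intros state c) simp
  qed (use shear(1) in \<open>simp add: moves_with_speed_def\<close>)
  have m5: "(deriv (x5 w) \<longlongrightarrow> lam R) (at_right 0)"
  proof (rule speed_at_origin[OF regions(3)])
    show "((\<lambda>z. u1 V z + c V z / sqrt 3) \<longlongrightarrow> lam R) (at (0, 0) within star w T R)"
      unfolding assms(13) by (intro tendsto_intros state c) simp
  qed (use shear(2) in \<open>simp add: moves_with_speed_def\<close>)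
  have "g K * lim0 (sstar w T K) (dt (p22 V)) = f K" for K
  proof (cases K)
    case L
    show ?thesis
      using dt_p22_across_shear[OF regions(1,2) smooth lims assms(3,4) pos(1,1,2) m2 shear(3,4) assms(7,8)]
      unfolding L assms(16-19) assms(10) .
  next
    case R
    show ?thesis
      using dt_p22_across_shear[OF regions(3,4) smooth lims assms(3,4) pos(1,1,2) m5 shear(5,6) assms(7,8)]
      unfolding R assms(16-19) assms(10) .
  qed
  moreover have "lim0 (sstar w T R) (D (\<lambda>_. lam R) (p12 V))
      = Dp12_ss - rho_s R * (lam R - u1_s) * Du2_ss"
  proof -
    have u: "(u1 V \<longlongrightarrow> u1_s) (at (0, 0) within sstar w T R)"
      using origin_limits(1)[OF lims(2) nb(2), of "u1 V" R] assms(4)[of R] by (simp add: lim_state_def)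
    have "lim0 (sstar w T R) (dx (p12 V)) = - rho_s R * Du2_ss"
      using equations_at_origin(1)[OF smooth(2)[of R] lims(2) nb(2) assms(4) pos] pos(1)[of R]
      unfolding assms(9) by (simp add: field_simps del: sstar.simps)
    then show ?thesis
      using lim0_D(1)[OF lims(2) nb(2) components_mem(5) tendsto_const, of R "lam R"]
        lim0_D(1)[OF lims(2) nb(2) components_mem(5) u] assms(10)[of R]
      by (simp add: algebra_simps)
  qed
  ultimately show ?thesis by blast
qed

end
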